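(* Define $\overline{\Psi}:\overline{\mathfrak{P}}\to\overline{\mathfrak{PB}}$ as the identity on objects and by $\overline{\Psi}((\alpha,k)):=(\Psi(\alpha),k)$ on morphisms. Then $$\overline{\Psi}((\beta,m)\diamond(\alpha,k))=\overline{\Psi}((\beta,m))\diamond\overline{\Psi}((\alpha,k))$$ for all composable morphisms $(\alpha,k)$ and $(\beta,m)$ in $\overline{\mathfrak{P}}$, i.e. for all finite sets $X,Y,Z$, all $(\alpha,k)\in\overline{\mathfrak{P}}(X,Y)$ and all $(\beta,m)\in\overline{\mathfrak{P}}(Y,Z)$.
   Context: $\mathbb{N}_0$ is the set of non-negative integers. Partitioned binary relations. For finite sets $X,Y$, a partitioned binary relation (PBR) on $(X,Y)$ is a binary relation $\alpha\subseteq (X\coprod Y)^2$ on the disjoint union $X\coprod Y$; pairs $(a,b)\in\alpha$ are edges; $\mathfrak{PB}(X,Y)$ is the set of all PBRs on $(X,Y)$. Let $\alpha\in\mathfrak{PB}(X,Y)$, $\beta\in\mathfrak{PB}(Y,Z)$. An $(\alpha,\beta)$-connected sequence is a finite nonempty sequence $(a_1,b_1),\dots,(a_m,b_m)$ of edges, each taken from $\alpha$ or from $\beta$ (one keeps track of which) and regarded as pairs of elements of $X\coprod Y\coprod Z$, such that no two successive edges are taken from the same PBR and $b_i=a_{i+1}$ for $i=1,\dots,m-1$; it connects $a_1$ to $b_m$. $\beta\circ\alpha$ is the PBR on $(X,Z)$ such that, for $a,b\in X\coprod Z$, $(a,b)\in\beta\circ\alpha$ iff some $(\alpha,\beta)$-connected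 sequence connects $a$ to $b$. An edge of $\alpha$ or $\beta$ (considered as an edge of that PBR) is $(\alpha,\beta)$-frothy if it does not occur in any $(\alpha,\beta)$-connected sequence connecting two (not necessarily distinct) elements of $X\coprod Z$. An $(\alpha,\beta)$-frothy cycle is an $(\alpha,\beta)$-connected sequence $(a_1,b_1),\dots,(a_m,b_m)$ with $m\ge2$ such that $a_1=b_m$, the first and last edges come from different PBRs, and all edges are $(\alpha,\beta)$-frothy; such cycles are considered up to cyclic permutation. Two frothy cycles are elementary-equivalent if they contain a common edge which in both cycles appears as an edge of the same PBR; equivalence is the smallest equivalence relation containing elementary-equivalence. $\mathfrak{f}((\alpha,\beta))$ is the number of equivalence classes of $(\alpha,\beta)$-frothy cycles. $\overline{\mathfrak{PB}}$ has finite sets as objects, $\overline{\mathfrak{PB}}(X,Y)=\mathfrak{PB}(X,Y)\times\mathbb{N}_0$, and composition $(\beta,m)\diamond(\alpha,k)=(\beta\circ\alpha,\,m+k+\mathfrak{f}((\alpha,\beta)))$. Partitions. $\mathfrak{P}(X,Y)$ is the set of all partitions of $X\coprod Y$ into disjoint subsets (parts). For $\alpha\in\mathfrak{P}(X,Y)$, $\beta\in\mathfrak{P}(Y,Z)$, $\beta\circ\alpha\in\mathfrak{P}(X,Z)$ is the partition in which $a,b\in X\coprod Z$ are in the same part iff for some $k\in\mathbb{N}_0$ there is a sequence $a=a_0,a_1,\dots,a_k=b$ in $X\coprod Y\coprod Z$ such that for each $i$, $a_i$ and $a_{i+1}$ belong to the same part of $\alpha$ or of $\beta$. Let $Y'$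 be the set of $y\in Y$ for which there is no sequence $y=a_1,\dots,a_p$ in $X\coprod Y\coprod Z$ with $a_p\in X\coprod Z$ and every two consecutive elements in the same part of $\alpha$ or of $\beta$. On $Y'$ put $y_1\sim y_2$ iff there is a sequence $y_1=a_1,\dots,a_p=y_2$ in $Y$ with every two consecutive elements in the same part of $\alpha$ or of $\beta$; $\mathfrak{p}(\alpha,\beta)$ is the number of equivalence classes of $\sim$. The deformed partition category $\overline{\mathfrak{P}}$ has finite sets as objects, $\overline{\mathfrak{P}}(X,Y)=\mathfrak{P}(X,Y)\times\mathbb{N}_0$, and composition $(\beta,m)\diamond(\alpha,k)=(\beta\circ\alpha,\,m+k+\mathfrak{p}(\alpha,\beta))$. The map $\Psi$: for $\alpha\in\mathfrak{P}(X,Y)$, $\Psi(\alpha)\in\mathfrak{PB}(X,Y)$ is the PBR with $(a,b)\in\Psi(\alpha)$ iff $a,b\in X\coprod Y$ belong to the same part of $\alpha$. *)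

theory Defs
  imports "HOL-Library.Disjoint_Sets"
begin

text \<open>
  The disjoint union of X, Y and Z is \<open>X <+> (Y <+> Z)\<close>. The three maps below are the
  inclusions of the disjoint unions of two of the sets into it.
\<close>

definition emb_XY :: "'a + 'b \<Rightarrow> 'a + ('b + 'c)" where
  "emb_XY = map_sum id Inl"

definition emb_YZ :: "'b + 'c \<Rightarrow> 'a + ('b + 'c)" where
  "emb_YZ = Inr"

definition emb_XZ :: "'a + 'c \<Rightarrow> 'a + ('b + 'c)" where
  "emb_XZ = map_sum id Inr"

type_synonym ('a, 'b) pbr = "(('a + 'b) \<times> ('a + 'b)) set"

definition PB :: "'a set \<Rightarrow> 'b set \<Rightarrow> ('a, 'b) pbr set" where
  "PB X Y = Pow ((X <+> Y) \<times> (X <+> Y))"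

text \<open>
  An edge together with the relation it is taken from: the elements of \<open>\<alpha> <+> \<beta>\<close> are
  \<open>Inl e\<close> for an edge \<open>e\<close> of \<open>\<alpha>\<close> and \<open>Inr e\<close> for an edge \<open>e\<close> of \<open>\<beta>\<close>, so \<open>isl\<close> tells
  which relation an edge belongs to.
\<close>

type_synonym ('a, 'b, 'c) edge =
  "(('a + 'b) \<times> ('a + 'b)) + (('b + 'c) \<times> ('b + 'c))"

fun src :: "('a, 'b, 'c) edge \<Rightarrow> 'a + ('b + 'c)" where
  "src (Inl (a, b)) = emb_XY a"
| "src (Inr (a, b)) = emb_YZ a"

fun tgt :: "('a, 'b, 'c) edge \<Rightarrow> 'a + ('b + 'c)" where
  "tgt (Inl (a, b)) = emb_XY b"
| "tgt (Inr (a, b)) = emb_YZ b"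

definition connected_seq ::
  "('a, 'b) pbr \<Rightarrow> ('b, 'c) pbr \<Rightarrow> ('a, 'b, 'c) edge list \<Rightarrow> bool" where
  "connected_seq \<alpha> \<beta> es \<longleftrightarrow>
     es \<noteq> [] \<and> set es \<subseteq> \<alpha> <+> \<beta> \<and>
     successively (\<lambda>e e'. isl e \<noteq> isl e' \<and> tgt e = src e') es"

definition connects ::
  "('a, 'b, 'c) edge list \<Rightarrow> 'a + ('b + 'c) \<Rightarrow> 'a + ('b + 'c) \<Rightarrow> bool" where
  "connects es u v \<longleftrightarrow> src (hd es) = u \<and> tgt (last es) = v"

text \<open>
  The middle set Y is no argument of the operations on relations: the edges of \<open>\<alpha>\<close> and
  \<open>\<beta>\<close> determine all the vertices that a connected sequence can visit.
\<close>

definition pb_comp ::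
  "'a set \<Rightarrow> 'c set \<Rightarrow> ('b, 'c) pbr \<Rightarrow> ('a, 'b) pbr \<Rightarrow> ('a, 'c) pbr" where
  "pb_comp X Z \<beta> \<alpha> =
     {(a, b). a \<in> X <+> Z \<and> b \<in> X <+> Z \<and>
        (\<exists>es. connected_seq \<alpha> \<beta> es \<and> connects es (emb_XZ a) (emb_XZ b))}"

definition frothy ::
  "'a set \<Rightarrow> 'c set \<Rightarrow> ('a, 'b) pbr \<Rightarrow> ('b, 'c) pbr \<Rightarrow> ('a, 'b, 'c) edge \<Rightarrow> bool" where
  "frothy X Z \<alpha> \<beta> e \<longleftrightarrow> e \<in> \<alpha> <+> \<beta> \<and>
     \<not> (\<exists>es. \<exists>a \<in> X <+> Z. \<exists>b \<in> X <+> Z.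
           connected_seq \<alpha> \<beta> es \<and> connects es (emb_XZ a) (emb_XZ b) \<and> e \<in> set es)"

definition frothy_cycle_seq ::
  "'a set \<Rightarrow> 'c set \<Rightarrow> ('a, 'b) pbr \<Rightarrow> ('b, 'c) pbr \<Rightarrow> ('a, 'b, 'c) edge list \<Rightarrow> bool" where
  "frothy_cycle_seq X Z \<alpha> \<beta> es \<longleftrightarrow>
     connected_seq \<alpha> \<beta> es \<and> length es \<ge> 2 \<and> src (hd es) = tgt (last es) \<and>
     isl (hd es) \<noteq> isl (last es) \<and> (\<forall>e \<in> set es. frothy X Z \<alpha> \<beta> e)"

text \<open>A cycle is the set of all cyclic permutations of a sequence representing it.\<close>

definition cyclic_class :: "'e list \<Rightarrow> 'e list set" where
  "cyclic_class es = {rotate n es | n. True}"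

definition frothy_cycles ::
  "'a set \<Rightarrow> 'c set \<Rightarrow> ('a, 'b) pbr \<Rightarrow> ('b, 'c) pbr \<Rightarrow> ('a, 'b, 'c) edge list set set" where
  "frothy_cycles X Z \<alpha> \<beta> = cyclic_class ` {es. frothy_cycle_seq X Z \<alpha> \<beta> es}"

definition elementary_equiv ::
  "'a set \<Rightarrow> 'c set \<Rightarrow> ('a, 'b) pbr \<Rightarrow> ('b, 'c) pbr \<Rightarrow>
     (('a, 'b, 'c) edge list set \<times> ('a, 'b, 'c) edge list set) set" where
  "elementary_equiv X Z \<alpha> \<beta> =
     {(C, D). C \<in> frothy_cycles X Z \<alpha> \<beta> \<and> D \<in> frothy_cycles X Z \<alpha> \<beta> \<and>
        (\<exists>c \<in> C. \<exists>d \<in> D. set c \<inter> set d \<noteq> {})}"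

definition cycle_equiv ::
  "'a set \<Rightarrow> 'c set \<Rightarrow> ('a, 'b) pbr \<Rightarrow> ('b, 'c) pbr \<Rightarrow>
     (('a, 'b, 'c) edge list set \<times> ('a, 'b, 'c) edge list set) set" where
  "cycle_equiv X Z \<alpha> \<beta> =
     \<Inter> {R. equiv (frothy_cycles X Z \<alpha> \<beta>) R \<and> elementary_equiv X Z \<alpha> \<beta> \<subseteq> R}"

text \<open>
  There may be infinitely many frothy cycles, but only finitely many classes; see
  \<open>finite_cycle_classes\<close> below.
\<close>

definition froth :: "'a set \<Rightarrow> 'c set \<Rightarrow> ('a, 'b) pbr \<Rightarrow> ('b, 'c) pbr \<Rightarrow> nat" where
  "froth X Z \<alpha> \<beta> = card (frothy_cycles X Z \<alpha> \<beta> // cycle_equiv X Z \<alpha> \<beta>)"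

definition PBbar :: "'a set \<Rightarrow> 'b set \<Rightarrow> (('a, 'b) pbr \<times> nat) set" where
  "PBbar X Y = PB X Y \<times> UNIV"

fun pbbar_comp ::
  "'a set \<Rightarrow> 'c set \<Rightarrow> ('b, 'c) pbr \<times> nat \<Rightarrow> ('a, 'b) pbr \<times> nat \<Rightarrow> ('a, 'c) pbr \<times> nat" where
  "pbbar_comp X Z (\<beta>, m) (\<alpha>, k) = (pb_comp X Z \<beta> \<alpha>, m + k + froth X Z \<alpha> \<beta>)"

type_synonym ('a, 'b) parts = "('a + 'b) set set"

definition Part :: "'a set \<Rightarrow> 'b set \<Rightarrow> ('a, 'b) parts set" where
  "Part X Y = {\<alpha>. partition_on (X <+> Y) \<alpha>}"

definition same_part ::
  "('a, 'b) parts \<Rightarrow> ('b, 'c) parts \<Rightarrow> 'a + ('b + 'c) \<Rightarrow> 'a + ('b + 'c) \<Rightarrow> bool" where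
  "same_part \<alpha> \<beta> u v \<longleftrightarrow>
     (\<exists>A \<in> \<alpha>. u \<in> emb_XY ` A \<and> v \<in> emb_XY ` A) \<or>
     (\<exists>B \<in> \<beta>. u \<in> emb_YZ ` B \<and> v \<in> emb_YZ ` B)"

text \<open>The sequence may consist of a single element, in which case \<open>u = v\<close>.\<close>

definition linked_in ::
  "('a + ('b + 'c)) set \<Rightarrow> ('a, 'b) parts \<Rightarrow> ('b, 'c) parts \<Rightarrow>
     'a + ('b + 'c) \<Rightarrow> 'a + ('b + 'c) \<Rightarrow> bool" where
  "linked_in S \<alpha> \<beta> u v \<longleftrightarrow>
     (\<exists>as. as \<noteq> [] \<and> set as \<subseteq> S \<and> hd as = u \<and> last as = v \<and> successively (same_part \<alpha> \<beta>) as)"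

definition part_comp_rel ::
  "'a set \<Rightarrow> 'b set \<Rightarrow> 'c set \<Rightarrow> ('b, 'c) parts \<Rightarrow> ('a, 'b) parts \<Rightarrow>
     (('a + 'c) \<times> ('a + 'c)) set" where
  "part_comp_rel X Y Z \<beta> \<alpha> =
     {(a, b). a \<in> X <+> Z \<and> b \<in> X <+> Z \<and>
        linked_in (X <+> (Y <+> Z)) \<alpha> \<beta> (emb_XZ a) (emb_XZ b)}"

definition part_comp ::
  "'a set \<Rightarrow> 'b set \<Rightarrow> 'c set \<Rightarrow> ('b, 'c) parts \<Rightarrow> ('a, 'b) parts \<Rightarrow> ('a, 'c) parts" where
  "part_comp X Y Z \<beta> \<alpha> = (X <+> Z) // part_comp_rel X Y Z \<beta> \<alpha>"

definition inner_points ::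
  "'a set \<Rightarrow> 'b set \<Rightarrow> 'c set \<Rightarrow> ('a, 'b) parts \<Rightarrow> ('b, 'c) parts \<Rightarrow> 'b set" where
  "inner_points X Y Z \<alpha> \<beta> =
     {y \<in> Y. \<not> (\<exists>v \<in> X <+> Z. linked_in (X <+> (Y <+> Z)) \<alpha> \<beta> (Inr (Inl y)) (emb_XZ v))}"

definition inner_rel ::
  "'a set \<Rightarrow> 'b set \<Rightarrow> 'c set \<Rightarrow> ('a, 'b) parts \<Rightarrow> ('b, 'c) parts \<Rightarrow> ('b \<times> 'b) set" where
  "inner_rel X Y Z \<alpha> \<beta> =
     {(y1, y2). y1 \<in> inner_points X Y Z \<alpha> \<beta> \<and> y2 \<in> inner_points X Y Z \<alpha> \<beta> \<and>
        linked_in ((\<lambda>y. Inr (Inl y)) ` Y) \<alpha> \<beta> (Inr (Inl y1)) (Inr (Inl y2))}"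

definition inner_count ::
  "'a set \<Rightarrow> 'b set \<Rightarrow> 'c set \<Rightarrow> ('a, 'b) parts \<Rightarrow> ('b, 'c) parts \<Rightarrow> nat" where
  "inner_count X Y Z \<alpha> \<beta> = card (inner_points X Y Z \<alpha> \<beta> // inner_rel X Y Z \<alpha> \<beta>)"

definition Pbar :: "'a set \<Rightarrow> 'b set \<Rightarrow> (('a, 'b) parts \<times> nat) set" where
  "Pbar X Y = Part X Y \<times> UNIV"

fun pbar_comp ::
  "'a set \<Rightarrow> 'b set \<Rightarrow> 'c set \<Rightarrow> ('b, 'c) parts \<times> nat \<Rightarrow> ('a, 'b) parts \<times> nat \<Rightarrow>
     ('a, 'c) parts \<times> nat" where
  "pbar_comp X Y Z (\<beta>, m) (\<alpha>, k) = (part_comp X Y Z \<beta> \<alpha>, m + k + inner_count X Y Z \<alpha> \<beta>)"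

definition Psi :: "('a, 'b) parts \<Rightarrow> ('a, 'b) pbr" where
  "Psi \<alpha> = {(a, b). \<exists>A \<in> \<alpha>. a \<in> A \<and> b \<in> A}"

fun Psibar :: "('a, 'b) parts \<times> nat \<Rightarrow> ('a, 'b) pbr \<times> nat" where
  "Psibar (\<alpha>, k) = (Psi \<alpha>, k)"

lemma emb_XZ_in: "a \<in> X <+> Z \<Longrightarrow> emb_XZ a \<in> X <+> (Y <+> Z)"
  by (auto simp: emb_XZ_def)

lemma linked_in_refl: "u \<in> S \<Longrightarrow> linked_in S \<alpha> \<beta> u u"
  unfolding linked_in_def by (intro exI[of _ "[u]"]) auto

lemma linked_in_sym:
  assumes "linked_in S \<alpha> \<beta> u v"
  shows "linked_in S \<alpha> \<beta> v u"
proof -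
  obtain as where as: "as \<noteq> []" "set as \<subseteq> S" "hd as = u" "last as = v"
      "successively (same_part \<alpha> \<beta>) as"
    using assms unfolding linked_in_def by blast
  have flip: "(\<lambda>x y. same_part \<alpha> \<beta> y x) = same_part \<alpha> \<beta>"
    by (auto simp: same_part_def fun_eq_iff)
  have "successively (same_part \<alpha> \<beta>) (rev as)"
    unfolding successively_rev flip by (rule as(5))
  then show ?thesis
    unfolding linked_in_def using as
    by (intro exI[of _ "rev as"]) (simp add: hd_rev last_rev)
qed

lemma linked_in_trans:
  assumes "linked_in S \<alpha> \<beta> u v" "linked_in S \<alpha> \<beta> v w"
  shows "linked_in S \<alpha> \<beta> u w"
proof -
  obtain as where as: "as \<noteq> []" "set as \<subseteq> S" "hd as = u" "last as = v"
      "successively (same_part \<alpha> \<beta>) as"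
    using assms(1) unfolding linked_in_def by blast
  obtain bs where bs: "bs \<noteq> []" "set bs \<subseteq> S" "hd bs = v" "last bs = w"
      "successively (same_part \<alpha> \<beta>) bs"
    using assms(2) unfolding linked_in_def by blast
  obtain cs where cs: "bs = v # cs"
    using bs(1,3) by (cases bs) auto
  have "successively (same_part \<alpha> \<beta>) (as @ cs)"
    using as bs(5) cs by (auto simp: successively_append_iff successively_Cons)
  moreover have "last (as @ cs) = w"
    using as(4) bs(4) cs by (auto split: if_splits)
  ultimately show ?thesis
    unfolding linked_in_def using as bs cs by (intro exI[of _ "as @ cs"]) auto
qed

lemma equiv_part_comp_rel: "equiv (X <+> Z) (part_comp_rel X Y Z \<beta> \<alpha>)"
proof (rule equivI)
  show "part_comp_rel X Y Z \<beta> \<alpha> \<subseteq> (X <+> Z) \<times> (X <+> Z)"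
    by (auto simp: part_comp_rel_def)
  show "refl_on (X <+> Z) (part_comp_rel X Y Z \<beta> \<alpha>)"
    unfolding refl_on_def part_comp_rel_def
    using linked_in_refl emb_XZ_in by blast
  show "sym (part_comp_rel X Y Z \<beta> \<alpha>)"
    unfolding sym_def part_comp_rel_def using linked_in_sym by blast
  show "trans (part_comp_rel X Y Z \<beta> \<alpha>)"
    unfolding trans_def part_comp_rel_def using linked_in_trans by blast
qed

lemma equiv_inner_rel: "equiv (inner_points X Y Z \<alpha> \<beta>) (inner_rel X Y Z \<alpha> \<beta>)"
proof (rule equivI)
  show "inner_rel X Y Z \<alpha> \<beta> \<subseteq> inner_points X Y Z \<alpha> \<beta> \<times> inner_points X Y Z \<alpha> \<beta>"
    by (auto simp: inner_rel_def)
  show "refl_on (inner_points X Y Z \<alpha> \<beta>) (inner_rel X Y Z \<alpha> \<beta>)"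
    unfolding refl_on_def inner_rel_def
    by (auto intro!: linked_in_refl simp: inner_points_def)
  show "sym (inner_rel X Y Z \<alpha> \<beta>)"
    unfolding sym_def inner_rel_def using linked_in_sym by blast
  show "trans (inner_rel X Y Z \<alpha> \<beta>)"
    unfolding trans_def inner_rel_def using linked_in_trans by blast
qed

lemma equiv_cycle_equiv: "equiv (frothy_cycles X Z \<alpha> \<beta>) (cycle_equiv X Z \<alpha> \<beta>)"
proof -
  let ?F = "frothy_cycles X Z \<alpha> \<beta>"
  have full: "equiv ?F (?F \<times> ?F)"
    by (auto intro!: equivI simp: refl_on_def sym_def trans_def)
  have elem: "elementary_equiv X Z \<alpha> \<beta> \<subseteq> ?F \<times> ?F"
    by (auto simp: elementary_equiv_def)
  show ?thesis
  proof (rule equivI)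
    show "cycle_equiv X Z \<alpha> \<beta> \<subseteq> ?F \<times> ?F"
      unfolding cycle_equiv_def using full elem by blast
    show "refl_on ?F (cycle_equiv X Z \<alpha> \<beta>)"
      unfolding cycle_equiv_def refl_on_def by (auto simp: equiv_def refl_on_def)
    show "sym (cycle_equiv X Z \<alpha> \<beta>)"
      unfolding cycle_equiv_def sym_def by (auto simp: equiv_def sym_def)
    show "trans (cycle_equiv X Z \<alpha> \<beta>)"
      unfolding cycle_equiv_def
      by (rule transI) (auto simp: equiv_def dest: transD)
  qed
qed

lemma elementary_equiv_subset: "elementary_equiv X Z \<alpha> \<beta> \<subseteq> cycle_equiv X Z \<alpha> \<beta>"
  unfolding cycle_equiv_def by blast

lemma frothy_cycle_edge:
  assumes "C \<in> frothy_cycles X Z \<alpha> \<beta>"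
  shows "\<exists>e \<in> \<alpha> <+> \<beta>. \<exists>c \<in> C. e \<in> set c"
proof -
  obtain es where es: "C = cyclic_class es" "frothy_cycle_seq X Z \<alpha> \<beta> es"
    using assms by (auto simp: frothy_cycles_def)
  have "es \<in> C"
    unfolding es(1) cyclic_class_def by (auto intro: exI[of _ 0])
  moreover have "hd es \<in> set es" "set es \<subseteq> \<alpha> <+> \<beta>"
    using es(2) by (auto simp: frothy_cycle_seq_def connected_seq_def)
  ultimately show ?thesis by blast
qed

lemma finite_cycle_classes:
  assumes "finite \<alpha>" "finite \<beta>"
  shows "finite (frothy_cycles X Z \<alpha> \<beta> // cycle_equiv X Z \<alpha> \<beta>)" (is "finite ?Q")
proof -
  note eq = equiv_cycle_equiv[of X Z \<alpha> \<beta>]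
  have "\<exists>e. \<exists>C \<in> q. e \<in> \<alpha> <+> \<beta> \<and> (\<exists>c \<in> C. e \<in> set c)" if q: "q \<in> ?Q" for q
  proof -
    obtain C where C: "C \<in> q" "C \<in> frothy_cycles X Z \<alpha> \<beta>"
      using q in_quotient_imp_non_empty[OF eq q] in_quotient_imp_subset[OF eq q] by blast
    then show ?thesis using frothy_cycle_edge by blast
  qed
  then obtain g where g: "\<And>q. q \<in> ?Q \<Longrightarrow>
      \<exists>C \<in> q. g q \<in> \<alpha> <+> \<beta> \<and> (\<exists>c \<in> C. g q \<in> set c)"
    by metis
  have "inj_on g ?Q"
  proof (rule inj_onI)
    fix p q assume pq: "p \<in> ?Q" "q \<in> ?Q" "g p = g q"
    obtain C c where C: "C \<in> p" "c \<in> C" "g p \<in> set c" using g pq(1) by blast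
    obtain D d where D: "D \<in> q" "d \<in> D" "g p \<in> set d" using g pq(2,3) by force
    have "C \<in> frothy_cycles X Z \<alpha> \<beta>" "D \<in> frothy_cycles X Z \<alpha> \<beta>"
      using in_quotient_imp_subset[OF eq] C D pq by blast+
    then have "(C, D) \<in> elementary_equiv X Z \<alpha> \<beta>"
      unfolding elementary_equiv_def using C D by blast
    then have "(C, D) \<in> cycle_equiv X Z \<alpha> \<beta>"
      using elementary_equiv_subset by blast
    then show "p = q"
      using quotient_eqI[OF eq pq(1,2) C(1) D(1)] by blast
  qed
  moreover have "g ` ?Q \<subseteq> \<alpha> <+> \<beta>" using g by blast
  ultimately show ?thesis
    using assms by (meson finite_Plus finite_subset finite_imageD)
qed

lemma pb_comp_in_PB: "pb_comp X Z \<beta> \<alpha> \<in> PB X Z"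
  by (auto simp: pb_comp_def PB_def)

lemma part_comp_in_Part: "part_comp X Y Z \<beta> \<alpha> \<in> Part X Z"
  unfolding Part_def part_comp_def
  using partition_on_quotient[OF equiv_part_comp_rel] by blast

lemma Psibar_in_PBbar: "f \<in> Pbar X Y \<Longrightarrow> Psibar f \<in> PBbar X Y"
  by (cases f) (auto simp: Pbar_def PBbar_def Part_def PB_def Psi_def dest: partition_onD1)

end

theory Submission
  imports Defs
begin

text \<open>
  Both compositions, and both numbers of discarded components, are governed by connectivity
  in one graph: its vertices are the points of \<open>X <+> (Y <+> Z)\<close> and its edges are the pairs
  of points in a common part of \<open>\<alpha>\<close> or of \<open>\<beta>\<close>.

  For the relations, an alternating sequence of edges is a special walk in that graph.
  Conversely, since being in a common part is transitive, two successive edges from the same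
  partition can be merged into one, so that every walk can be made alternating
  (\<open>linked_iff_connected\<close>). Hence \<open>\<Psi>\<close> respects the underlying compositions.

  For the exponents, the loops at the points of \<open>Y\<close>, which belong to both relations, allow one
  to switch from one relation to the other at any middle point, and so an edge is frothy exactly
  if its component avoids \<open>X\<close> and \<open>Z\<close> (\<open>frothy_iff\<close>). Every inner point \<open>y\<close> thus carries a
  frothy cycle formed by its two loops. If an edge \<open>e\<close> joins the inner points \<open>y\<close> and \<open>y'\<close>, the
  cycle that runs along \<open>e\<close>, waits at \<open>y'\<close>, runs back and waits at \<open>y\<close> shares edges with
  the loop cycles at \<open>y\<close> and \<open>y'\<close> and with every frothy cycle through \<open>e\<close>. Consequently every
  frothy cycle is equivalent to the loop cycle at each of its points, and loop cycles in one
  component are equivalent. Since a frothy cycle never leaves its component, loop cycles in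
  different components are not. So the equivalence classes of frothy cycles correspond to the
  components inside \<open>Y\<close>.
\<close>

section \<open>Quotients by equivalence relations\<close>

lemma Psi_quotient:
  assumes "equiv A r"
  shows "Psi (A // r) = r"
proof -
  have "(\<exists>C \<in> A // r. a \<in> C \<and> b \<in> C) \<longleftrightarrow> (a, b) \<in> r" for a b
  proof
    assume "\<exists>C \<in> A // r. a \<in> C \<and> b \<in> C"
    then show "(a, b) \<in> r"
      using in_quotient_imp_in_rel[OF assms] by blast
  next
    assume ab: "(a, b) \<in> r"
    then have "a \<in> A" using assms by (auto simp: equiv_def)
    then show "\<exists>C \<in> A // r. a \<in> C \<and> b \<in> C"
      using ab equiv_class_self[OF assms] by (intro bexI[of _ "r `` {a}"]) (auto intro: quotientI)
  qed
  then show ?thesis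
    unfolding Psi_def by auto
qed

lemma card_quotient_eq:
  assumes r: "equiv A r" and s: "equiv B s"
    and into: "\<And>x. x \<in> A \<Longrightarrow> f x \<in> B"
    and iff: "\<And>x y. x \<in> A \<Longrightarrow> y \<in> A \<Longrightarrow> (x, y) \<in> r \<longleftrightarrow> (f x, f y) \<in> s"
    and dense: "\<And>b. b \<in> B \<Longrightarrow> \<exists>x \<in> A. (b, f x) \<in> s"
  shows "card (A // r) = card (B // s)"
proof -
  let ?g = "\<lambda>c. s `` (f ` c)"
  have g: "?g (r `` {x}) = s `` {f x}" if x: "x \<in> A" for x
  proof
    show "?g (r `` {x}) \<subseteq> s `` {f x}"
    proof
      fix b assume "b \<in> ?g (r `` {x})"
      then obtain y where y: "(x, y) \<in> r" "(f y, b) \<in> s" by blast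
      have "y \<in> A" using y(1) r by (auto simp: equiv_def)
      then have "(f x, f y) \<in> s" using iff x y(1) by blast
      then show "b \<in> s `` {f x}" using y(2) s by (auto simp: equiv_def dest: transD)
    qed
    show "s `` {f x} \<subseteq> ?g (r `` {x})"
      using equiv_class_self[OF r x] by blast
  qed
  have "inj_on ?g (A // r)"
  proof (rule inj_onI)
    fix c d assume "c \<in> A // r" "d \<in> A // r" and eq: "?g c = ?g d"
    then obtain x y where x: "x \<in> A" "c = r `` {x}" and y: "y \<in> A" "d = r `` {y}"
      by (auto elim!: quotientE)
    have "(f x, f y) \<in> s"
      using eq g x y eq_equiv_class[OF _ s] into by metis
    then have "(x, y) \<in> r" using iff x y by blast
    then show "c = d" using equiv_class_eq[OF r] x y by blast
  qed
  moreover have "?g ` (A // r) = B // s"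
  proof
    show "?g ` (A // r) \<subseteq> B // s"
    proof
      fix q assume "q \<in> ?g ` (A // r)"
      then obtain x where "x \<in> A" "q = ?g (r `` {x})" by (auto elim!: quotientE)
      then show "q \<in> B // s" using g quotientI[OF into] by simp
    qed
    show "B // s \<subseteq> ?g ` (A // r)"
    proof
      fix q assume "q \<in> B // s"
      then obtain b where b: "b \<in> B" "q = s `` {b}" by (auto elim!: quotientE)
      then obtain x where x: "x \<in> A" "(b, f x) \<in> s" using dense by blast
      then have "q = ?g (r `` {x})" using g[OF x(1)] b equiv_class_eq[OF s] by simp
      then show "q \<in> ?g ` (A // r)" using quotientI[OF x(1)] by (rule image_eqI)
    qed
  qed
  ultimately show ?thesis
    using card_image by metis
qed

section \<open>The graph of two composable partitions\<close>

lemma linked_in_step: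
  assumes "linked_in S \<alpha> \<beta> u v" "same_part \<alpha> \<beta> v w" "w \<in> S"
  shows "linked_in S \<alpha> \<beta> u w"
proof -
  obtain as where as: "as \<noteq> []" "set as \<subseteq> S" "hd as = u" "last as = v"
      "successively (same_part \<alpha> \<beta>) as"
    using assms(1) unfolding linked_in_def by blast
  then show ?thesis
    unfolding linked_in_def using assms(2,3)
    by (intro exI[of _ "as @ [w]"]) (auto simp: successively_append_iff)
qed

lemma linked_in_induct [consumes 1, case_names start step]:
  assumes "linked_in S \<alpha> \<beta> u v"
    and start: "u \<in> S \<Longrightarrow> P u"
    and step: "\<And>x y. linked_in S \<alpha> \<beta> u x \<Longrightarrow> P x \<Longrightarrow> same_part \<alpha> \<beta> x y \<Longrightarrow> y \<in> S \<Longrightarrow> P y"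
  shows "P v"
proof -
  obtain as where as: "as \<noteq> []" "set as \<subseteq> S" "hd as = u" "last as = v"
      "successively (same_part \<alpha> \<beta>) as"
    using assms(1) unfolding linked_in_def by blast
  have "P (last as)" using as(1,2,3,5)
  proof (induction as rule: rev_nonempty_induct)
    case (single x)
    then show ?case using start by simp
  next
    case (snoc y xs)
    then have xs: "set xs \<subseteq> S" "hd xs = u" "successively (same_part \<alpha> \<beta>) xs"
        "same_part \<alpha> \<beta> (last xs) y" "y \<in> S"
      by (auto simp: successively_append_iff)
    then have "linked_in S \<alpha> \<beta> u (last xs)"
      unfolding linked_in_def using snoc.hyps by blast
    then show ?case using snoc xs step[of "last xs" y] by auto
  qed
  then show ?thesis using as(4) by simp
qed

fun rev_edge :: "('a, 'b, 'c) edge \<Rightarrow> ('a, 'b, 'c) edge" where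
  "rev_edge (Inl (a, b)) = Inl (b, a)"
| "rev_edge (Inr (a, b)) = Inr (b, a)"

lemma rev_edge_simps [simp]:
  "isl (rev_edge e) = isl e" "src (rev_edge e) = tgt e" "tgt (rev_edge e) = src e"
  "rev_edge (rev_edge e) = e"
  by (cases e rule: rev_edge.cases; simp)+

abbreviation mid :: "'b \<Rightarrow> 'a + ('b + 'c)" where
  "mid y \<equiv> Inr (Inl y)"

definition loop :: "bool \<Rightarrow> 'b \<Rightarrow> ('a, 'b, 'c) edge" where
  "loop s y = (if s then Inl (Inr y, Inr y) else Inr (Inl y, Inl y))"

lemma loop_simps [simp]:
  "isl (loop s y) = s" "src (loop s y) = mid y" "tgt (loop s y) = mid y"
  by (auto simp: loop_def emb_XY_def emb_YZ_def)

locale composable_partitions =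
  fixes X :: "'a set" and Y :: "'b set" and Z :: "'c set"
    and \<alpha> :: "('a, 'b) parts" and \<beta> :: "('b, 'c) parts"
  assumes part_\<alpha>: "partition_on (X <+> Y) \<alpha>" and part_\<beta>: "partition_on (Y <+> Z) \<beta>"
begin

abbreviation V :: "('a + ('b + 'c)) set" where
  "V \<equiv> X <+> (Y <+> Z)"

abbreviation E :: "('a, 'b, 'c) edge set" where
  "E \<equiv> Psi \<alpha> <+> Psi \<beta>"

abbreviation conn :: "('a, 'b, 'c) edge list \<Rightarrow> bool" where
  "conn \<equiv> connected_seq (Psi \<alpha>) (Psi \<beta>)"

abbreviation fr :: "('a, 'b, 'c) edge \<Rightarrow> bool" where
  "fr \<equiv> frothy X Z (Psi \<alpha>) (Psi \<beta>)"

definition meets_boundary :: "'a + ('b + 'c) \<Rightarrow> bool" where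
  "meets_boundary u \<longleftrightarrow> (\<exists>v \<in> X <+> Z. linked_in V \<alpha> \<beta> u (emb_XZ v))"

lemma equiv_Psi: "equiv (X <+> Y) (Psi \<alpha>)" "equiv (Y <+> Z) (Psi \<beta>)"
  unfolding Psi_def using equiv_partition_on part_\<alpha> part_\<beta> by blast+

lemma rev_edge_in: "e \<in> E \<Longrightarrow> rev_edge e \<in> E"
  using equiv_Psi by (cases e rule: rev_edge.cases) (auto simp: equiv_def dest: symD)

lemma loop_in: "y \<in> Y \<Longrightarrow> loop s y \<in> E"
  using equiv_Psi by (auto simp: loop_def equiv_def refl_on_def)

lemma edge_trans:
  assumes "e \<in> E" "f \<in> E" "isl e = isl f" "tgt e = src f"
  shows "\<exists>g \<in> E. isl g = isl e \<and> src g = src e \<and> tgt g = tgt f"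
proof (cases e rule: rev_edge.cases)
  case (1 a b)
  then obtain b' c where f: "f = Inl (b', c)"
    using assms(3) by (cases f rule: rev_edge.cases) auto
  have "b' = b"
    using assms(4) 1 f by (cases b; cases b') (auto simp: emb_XY_def)
  then have "(a, c) \<in> Psi \<alpha>"
    using assms(1,2) 1 f equiv_Psi(1) by (auto simp: equiv_def dest: transD)
  then show ?thesis using 1 f by (intro bexI[of _ "Inl (a, c)"]) auto
next
  case (2 a b)
  then obtain b' c where f: "f = Inr (b', c)"
    using assms(3) by (cases f rule: rev_edge.cases) auto
  have "b' = b"
    using assms(4) 2 f by (auto simp: emb_YZ_def)
  then have "(a, c) \<in> Psi \<beta>"
    using assms(1,2) 2 f equiv_Psi(2) by (auto simp: equiv_def dest: transD)
  then show ?thesis using 2 f by (intro bexI[of _ "Inr (a, c)"]) auto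
qed

lemma same_part_iff: "same_part \<alpha> \<beta> u v \<longleftrightarrow> (\<exists>e \<in> E. src e = u \<and> tgt e = v)"
proof
  assume "same_part \<alpha> \<beta> u v"
  then consider
      A a b where "A \<in> \<alpha>" "a \<in> A" "b \<in> A" "u = emb_XY a" "v = emb_XY b"
    | B a b where "B \<in> \<beta>" "a \<in> B" "b \<in> B" "u = emb_YZ a" "v = emb_YZ b"
    unfolding same_part_def by blast
  then show "\<exists>e \<in> E. src e = u \<and> tgt e = v"
  proof cases
    case 1
    then show ?thesis by (intro bexI[of _ "Inl (a, b)"]) (auto simp: Psi_def)
  next
    case 2
    then show ?thesis by (intro bexI[of _ "Inr (a, b)"]) (auto simp: Psi_def)
  qed
next
  assume "\<exists>e \<in> E. src e = u \<and> tgt e = v"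
  then obtain e where e: "e \<in> E" "src e = u" "tgt e = v" by blast
  then show "same_part \<alpha> \<beta> u v"
    by (cases e rule: rev_edge.cases) (auto simp: same_part_def Psi_def)
qed

lemma edge_same_part: "e \<in> E \<Longrightarrow> same_part \<alpha> \<beta> (src e) (tgt e)"
  unfolding same_part_iff by blast

lemma src_in: "e \<in> E \<Longrightarrow> src e \<in> V"
  using equiv_Psi
  by (cases e rule: rev_edge.cases) (auto simp: equiv_def emb_XY_def emb_YZ_def)

lemma tgt_in: "e \<in> E \<Longrightarrow> tgt e \<in> V"
  using src_in[OF rev_edge_in] by simp

lemma vertex_cases:
  assumes "u \<in> V"
  obtains (middle) y where "y \<in> Y" "u = mid y"
    | (boundary) v where "v \<in> X <+> Z" "u = emb_XZ v"
proof -
  from assms consider x where "x \<in> X" "u = Inl x" | y where "y \<in> Y" "u = mid y"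
    | z where "z \<in> Z" "u = Inr (Inr z)" by blast
  then show ?thesis
  proof cases
    case 1
    then show ?thesis by (intro boundary[of "Inl x"]) (auto simp: emb_XZ_def)
  next
    case 2
    then show ?thesis by (rule middle)
  next
    case 3
    then show ?thesis by (intro boundary[of "Inr z"]) (auto simp: emb_XZ_def)
  qed
qed

lemma vertex_has_loop:
  assumes "u \<in> V"
  shows "\<exists>e \<in> E. src e = u \<and> tgt e = u"
proof -
  from assms consider x where "x \<in> X" "u = Inl x" | y where "y \<in> Y" "u = mid y"
    | z where "z \<in> Z" "u = Inr (Inr z)" by blast
  then show ?thesis
  proof cases
    case 1
    then have "(Inl x, Inl x) \<in> Psi \<alpha>"
      using equiv_Psi(1) by (auto simp: equiv_def refl_on_def)
    then show ?thesis using 1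
      by (intro bexI[of _ "Inl (Inl x, Inl x)"]) (auto simp: emb_XY_def)
  next
    case 2
    then show ?thesis using loop_in[of y True] by (intro bexI[of _ "loop True y"]) auto
  next
    case 3
    then have "(Inr z, Inr z) \<in> Psi \<beta>"
      using equiv_Psi(2) by (auto simp: equiv_def refl_on_def)
    then show ?thesis using 3
      by (intro bexI[of _ "Inr (Inr z, Inr z)"]) (auto simp: emb_YZ_def)
  qed
qed

section \<open>Walks and alternating sequences\<close>

lemma conn_single: "e \<in> E \<Longrightarrow> conn [e]"
  by (auto simp: connected_seq_def)

lemma conn_snoc:
  assumes "conn es" "e \<in> E" "isl (last es) \<noteq> isl e" "tgt (last es) = src e"
  shows "conn (es @ [e])"
  using assms by (auto simp: connected_seq_def successively_append_iff)

lemma conn_append_Cons: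
  "conn (xs @ e # ys) \<longleftrightarrow> conn (xs @ [e]) \<and> conn (e # ys)"
  by (auto simp: connected_seq_def successively_append_iff successively_Cons)

lemma conn_rev:
  assumes "conn es"
  shows "conn (rev (map rev_edge es))"
proof -
  have "successively (\<lambda>e e'. isl e' \<noteq> isl e \<and> src e = tgt e') (map rev_edge es)"
    using assms by (auto simp: connected_seq_def successively_map elim!: successively_mono)
  then show ?thesis
    using assms rev_edge_in
    by (auto simp: connected_seq_def successively_rev eq_commute elim!: successively_mono)
qed

lemma conn_imp_successively:
  assumes "conn es"
  shows "successively (same_part \<alpha> \<beta>) (map src es)"
proof -
  have es: "set es \<subseteq> E" "successively (\<lambda>e e'. isl e \<noteq> isl e' \<and> tgt e = src e') es"
    using assms by (simp_all add: connected_seq_def)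
  have "same_part \<alpha> \<beta> (src e) (src e')" if "e \<in> set es" "tgt e = src e'" for e e'
    using edge_same_part[OF subsetD[OF es(1) that(1)]] that(2) by simp
  then show ?thesis
    unfolding successively_map by (intro successively_mono[OF es(2)]) simp
qed

lemma conn_linked_src:
  assumes "conn es" "src ` set es \<subseteq> S" "e \<in> set es"
  shows "linked_in S \<alpha> \<beta> (src (hd es)) (src e)"
proof -
  obtain xs ys where es: "es = xs @ e # ys" using assms(3) by (meson split_list)
  then have "conn (xs @ [e])" using assms(1) conn_append_Cons by blast
  note succ = conn_imp_successively[OF this]
  have "hd (map src (xs @ [e])) = src (hd es)" unfolding es by (cases xs) simp_all
  moreover have "set (map src (xs @ [e])) \<subseteq> S" using assms(2) unfolding es by auto
  ultimately show ?thesis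
    unfolding linked_in_def using succ by (intro exI[of _ "map src (xs @ [e])"]) simp
qed

lemma conn_linked:
  assumes "conn es"
  shows "linked_in V \<alpha> \<beta> (src (hd es)) (tgt (last es))"
proof -
  have es: "es \<noteq> []" "set es \<subseteq> E" using assms by (simp_all add: connected_seq_def)
  have l: "last es \<in> set es" using es(1) by simp
  then have lE: "last es \<in> E" using es(2) by (rule subsetD[rotated])
  have "src ` set es \<subseteq> V" using es(2) src_in by blast
  then have "linked_in V \<alpha> \<beta> (src (hd es)) (src (last es))"
    by (rule conn_linked_src[OF assms _ l])
  moreover have "same_part \<alpha> \<beta> (src (last es)) (tgt (last es))"
    using lE by (rule edge_same_part)
  ultimately show ?thesis
    using tgt_in[OF lE] by (rule linked_in_step)
qed

text \<open>
  A walk becomes alternating by merging: an edge that follows one of the same relation is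
  composed with it by transitivity, and otherwise it is appended. The trivial walk at \<open>u\<close>
  becomes a loop at \<open>u\<close>.
\<close>

lemma linked_imp_conn:
  assumes "linked_in V \<alpha> \<beta> u v"
  shows "\<exists>es. conn es \<and> connects es u v"
  using assms
proof (induction rule: linked_in_induct)
  case start
  then obtain e where "e \<in> E" "src e = u" "tgt e = u" using vertex_has_loop by blast
  then show ?case by (intro exI[of _ "[e]"]) (simp add: conn_single connects_def)
next
  case (step x y)
  obtain es where es: "conn es" "connects es u x" using step.IH by blast
  obtain e where e: "e \<in> E" "src e = x" "tgt e = y"
    using step.hyps(2) unfolding same_part_iff by blast
  have ne: "es \<noteq> []" using es(1) by (simp add: connected_seq_def)
  then obtain fs l where fs: "es = fs @ [l]" by (metis rev_exhaust)
  have l: "l \<in> E" "tgt l = src e"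
    using es e(2) fs by (simp_all add: connected_seq_def connects_def)
  show ?case
  proof (cases "isl l = isl e")
    case False
    then have "conn (es @ [e])" using es(1) e(1) l fs by (intro conn_snoc) simp_all
    moreover have "connects (es @ [e]) u y"
      using es(2) e ne by (simp add: connects_def)
    ultimately show ?thesis by blast
  next
    case True
    then obtain g where g: "g \<in> E" "isl g = isl l" "src g = src l" "tgt g = tgt e"
      using edge_trans[OF l(1) e(1) _ l(2)] by blast
    have "conn (fs @ [g])"
      using es(1) g unfolding fs by (simp add: connected_seq_def successively_append_iff)
    moreover have "connects (fs @ [g]) u y"
      using es(2) e g unfolding fs by (cases fs) (simp_all add: connects_def)
    ultimately show ?thesis by blast
  qed
qed

lemma linked_iff_connected:
  "linked_in V \<alpha> \<beta> u v \<longleftrightarrow> (\<exists>es. conn es \<and> connects es u v)"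
proof
  show "\<exists>es. conn es \<and> connects es u v" if "linked_in V \<alpha> \<beta> u v"
    using that by (rule linked_imp_conn)
  show "linked_in V \<alpha> \<beta> u v" if "\<exists>es. conn es \<and> connects es u v"
    using that conn_linked by (auto simp: connects_def)
qed

lemma Psi_part_comp: "Psi (part_comp X Y Z \<beta> \<alpha>) = pb_comp X Z (Psi \<beta>) (Psi \<alpha>)"
  unfolding part_comp_def Psi_quotient[OF equiv_part_comp_rel]
  by (simp add: part_comp_rel_def pb_comp_def linked_iff_connected)

section \<open>Frothy edges\<close>

lemma meets_boundary_linked:
  "linked_in V \<alpha> \<beta> u w \<Longrightarrow> meets_boundary w \<Longrightarrow> meets_boundary u"
  unfolding meets_boundary_def using linked_in_trans by blast

lemma edge_linked: "e \<in> E \<Longrightarrow> linked_in V \<alpha> \<beta> (src e) (tgt e)"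
  using conn_linked[OF conn_single] by simp

lemma boundary_meets_boundary: "v \<in> X <+> Z \<Longrightarrow> meets_boundary (emb_XZ v)"
  unfolding meets_boundary_def using linked_in_refl emb_XZ_in by blast

text \<open>
  If an alternating sequence from the boundary arrives at the source of \<open>e\<close> with an edge of
  the same relation as \<open>e\<close>, then \<open>e\<close> cannot follow directly. At a middle point, a loop of the
  other relation in between restores the alternation; at a boundary point, the
  sequence may start with \<open>e\<close> instead.
\<close>

lemma conn_from_boundary:
  assumes "e \<in> E" "meets_boundary (src e)"
  shows "\<exists>es. \<exists>v \<in> X <+> Z. conn (es @ [e]) \<and> src (hd (es @ [e])) = emb_XZ v"
  using src_in[OF assms(1)]
proof (cases rule: vertex_cases)
  case (boundary v)
  then show ?thesis using conn_single assms(1) by (intro exI[of _ "[]"]) auto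
next
  case (middle y)
  obtain v where v: "v \<in> X <+> Z" "linked_in V \<alpha> \<beta> (emb_XZ v) (src e)"
    using assms(2) linked_in_sym unfolding meets_boundary_def by blast
  then obtain es where es: "conn es" "src (hd es) = emb_XZ v" "tgt (last es) = src e"
    using linked_imp_conn unfolding connects_def by blast
  have ne: "es \<noteq> []" using es(1) by (auto simp: connected_seq_def)
  show ?thesis
  proof (cases "isl (last es) = isl e")
    case False
    then have "conn (es @ [e])" using es assms(1) conn_snoc by blast
    then show ?thesis using v(1) es(2) ne by (intro exI[of _ es]) auto
  next
    case True
    let ?l = "loop (\<not> isl e) y"
    have "conn (es @ [?l])"
      using es True loop_in[OF middle(1)] middle(2) by (intro conn_snoc) auto
    then have "conn ((es @ [?l]) @ [e])"
      using assms(1) by (rule conn_snoc) (simp_all add: middle(2))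
    then show ?thesis
      using v(1) es(2) ne by (intro exI[of _ "es @ [?l]"]) auto
  qed
qed

lemma conn_to_boundary:
  assumes "e \<in> E" "meets_boundary (tgt e)"
  shows "\<exists>es. \<exists>v \<in> X <+> Z. conn (e # es) \<and> tgt (last (e # es)) = emb_XZ v"
proof -
  obtain es v where es: "v \<in> X <+> Z" "conn (es @ [rev_edge e])"
      "src (hd (es @ [rev_edge e])) = emb_XZ v"
    using conn_from_boundary[of "rev_edge e"] rev_edge_in assms by auto
  have "conn (e # rev (map rev_edge es))"
    using conn_rev[OF es(2)] by simp
  moreover have "tgt (last (e # rev (map rev_edge es))) = emb_XZ v"
    using es(3) by (cases es) auto
  ultimately show ?thesis using es(1) by blast
qed

text \<open>
  An edge whose component meets the boundary is reached from the boundary by an alternating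
  sequence that ends with it, and left by one that starts with it. Glued together at this edge
  they form one sequence, so that the edge is not frothy. Conversely, the end of any sequence
  containing an edge witnesses that its component meets the boundary.
\<close>

lemma frothy_iff: "fr e \<longleftrightarrow> e \<in> E \<and> \<not> meets_boundary (src e)"
proof
  assume fr: "fr e"
  then have e: "e \<in> E" by (simp add: frothy_def)
  moreover have False if b: "meets_boundary (src e)"
  proof -
    obtain xs v where xs: "v \<in> X <+> Z" "conn (xs @ [e])" "src (hd (xs @ [e])) = emb_XZ v"
      using conn_from_boundary[OF e b] by blast
    have "meets_boundary (tgt e)"
      by (rule meets_boundary_linked[OF linked_in_sym[OF edge_linked[OF e]] b])
    then obtain ys w where ys: "w \<in> X <+> Z" "conn (e # ys)" "tgt (last (e # ys)) = emb_XZ w"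
      using conn_to_boundary[OF e] by blast
    have "conn (xs @ e # ys)" using xs ys conn_append_Cons by blast
    moreover have "connects (xs @ e # ys) (emb_XZ v) (emb_XZ w)"
      using xs(3) ys(3) by (cases xs) (auto simp: connects_def)
    ultimately show False
      using fr xs(1) ys(1) unfolding frothy_def by (metis in_set_conv_decomp)
  qed
  ultimately show "e \<in> E \<and> \<not> meets_boundary (src e)" by blast
next
  assume e: "e \<in> E \<and> \<not> meets_boundary (src e)"
  have False if es: "conn es" "connects es u (emb_XZ b)" "e \<in> set es" "b \<in> X <+> Z" for es u b
  proof -
    obtain xs ys where split: "es = xs @ e # ys" using es(3) by (meson split_list)
    then have "conn (e # ys)" using es(1) conn_append_Cons by blast
    from conn_linked[OF this] have "linked_in V \<alpha> \<beta> (src e) (emb_XZ b)"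
      using es(2) split by (simp add: connects_def)
    then show False using e es(4) unfolding meets_boundary_def by blast
  qed
  then show "fr e" using e unfolding frothy_def by blast
qed

lemma inner_points_iff:
  "y \<in> inner_points X Y Z \<alpha> \<beta> \<longleftrightarrow> y \<in> Y \<and> \<not> meets_boundary (mid y)"
  by (simp add: inner_points_def meets_boundary_def)

lemma frothy_src:
  assumes "fr e"
  obtains y where "y \<in> inner_points X Y Z \<alpha> \<beta>" "src e = mid y"
proof -
  have "e \<in> E" "\<not> meets_boundary (src e)" using assms frothy_iff by auto
  from src_in[OF this(1)] show thesis
  proof (cases rule: vertex_cases)
    case (middle y)
    then show ?thesis
      using that inner_points_iff \<open>\<not> meets_boundary (src e)\<close> by metis
  next
    case (boundary v)
    then show ?thesis using boundary_meets_boundary \<open>\<not> meets_boundary (src e)\<close> by metis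
  qed
qed

lemma frothy_loop: "y \<in> inner_points X Y Z \<alpha> \<beta> \<Longrightarrow> fr (loop s y)"
  using loop_in by (auto simp: frothy_iff inner_points_iff)

lemma frothy_rev_edge:
  assumes "fr e"
  shows "fr (rev_edge e)"
proof -
  have "e \<in> E" "\<not> meets_boundary (src e)" using assms by (simp_all add: frothy_iff)
  then show ?thesis
    unfolding frothy_iff using rev_edge_in meets_boundary_linked[OF edge_linked] by auto
qed

section \<open>Classes of frothy cycles\<close>

abbreviation F :: "('a, 'b, 'c) edge list set set" where
  "F \<equiv> frothy_cycles X Z (Psi \<alpha>) (Psi \<beta>)"

abbreviation cycle_eq where
  "cycle_eq \<equiv> cycle_equiv X Z (Psi \<alpha>) (Psi \<beta>)"

abbreviation inner :: "'b set" where
  "inner \<equiv> inner_points X Y Z \<alpha> \<beta>"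

abbreviation inner_eq :: "('b \<times> 'b) set" where
  "inner_eq \<equiv> inner_rel X Y Z \<alpha> \<beta>"

definition cycle_edges :: "('a, 'b, 'c) edge list set \<Rightarrow> ('a, 'b, 'c) edge set" where
  "cycle_edges C = \<Union> (set ` C)"

lemma cycle_edges_cyclic_class [simp]: "cycle_edges (cyclic_class es) = set es"
  unfolding cycle_edges_def cyclic_class_def by auto

lemma cycle_eq_if_common_edge:
  assumes "C \<in> F" "D \<in> F" "e \<in> cycle_edges C" "e \<in> cycle_edges D"
  shows "(C, D) \<in> cycle_eq"
proof -
  have "(C, D) \<in> elementary_equiv X Z (Psi \<alpha>) (Psi \<beta>)"
    using assms unfolding elementary_equiv_def cycle_edges_def by blast
  then show ?thesis using elementary_equiv_subset by blast
qed

lemma cycle_eq_sym: "(C, D) \<in> cycle_eq \<Longrightarrow> (D, C) \<in> cycle_eq"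
  using equiv_cycle_equiv by (rule equivE) (erule symD)

lemma cycle_eq_trans: "(B, C) \<in> cycle_eq \<Longrightarrow> (C, D) \<in> cycle_eq \<Longrightarrow> (B, D) \<in> cycle_eq"
  using equiv_cycle_equiv by (rule equivE) (erule transD)

lemma inner_eq_sym: "(x, y) \<in> inner_eq \<Longrightarrow> (y, x) \<in> inner_eq"
  using equiv_inner_rel by (rule equivE) (erule symD)

lemma inner_eq_trans: "(x, y) \<in> inner_eq \<Longrightarrow> (y, z) \<in> inner_eq \<Longrightarrow> (x, z) \<in> inner_eq"
  using equiv_inner_rel by (rule equivE) (erule transD)

definition loop_cycle :: "'b \<Rightarrow> ('a, 'b, 'c) edge list set" where
  "loop_cycle y = cyclic_class [loop True y, loop False y]"

lemma loop_cycle_in: "y \<in> inner \<Longrightarrow> loop_cycle y \<in> F"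
  using frothy_loop[of y True] frothy_loop[of y False]
  by (auto simp: loop_cycle_def frothy_cycles_def frothy_cycle_seq_def connected_seq_def
      frothy_def)

lemma loop_in_loop_cycle: "loop s y \<in> cycle_edges (loop_cycle y)"
  by (cases s) (auto simp: loop_cycle_def)

text \<open>
  The bridge between cycles that visit a common component: traversing \<open>e\<close> in both directions
  and taking a loop of the other relation at either end gives a cycle that shares an edge with
  every cycle through \<open>e\<close>, and with the loop cycles at both ends of \<open>e\<close>.
\<close>

definition there_and_back ::
  "('a, 'b, 'c) edge \<Rightarrow> 'b \<Rightarrow> 'b \<Rightarrow> ('a, 'b, 'c) edge list set" where
  "there_and_back e y z =
     cyclic_class [e, loop (\<not> isl e) z, rev_edge e, loop (\<not> isl e) y]"

lemma there_and_back_in: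
  assumes "fr e" "src e = mid y" "tgt e = mid z"
  shows "there_and_back e y z \<in> F" "y \<in> inner" "z \<in> inner"
proof -
  have rev: "fr (rev_edge e)" using frothy_rev_edge assms(1) by blast
  show y: "y \<in> inner" using frothy_src[OF assms(1)] assms(2) by auto
  show z: "z \<in> inner" using frothy_src[OF rev] assms(3) by auto
  have "frothy_cycle_seq X Z (Psi \<alpha>) (Psi \<beta>)
      [e, loop (\<not> isl e) z, rev_edge e, loop (\<not> isl e) y]"
    using rev frothy_loop[OF y] frothy_loop[OF z] assms
    by (auto simp: frothy_cycle_seq_def connected_seq_def frothy_iff)
  then show "there_and_back e y z \<in> F"
    unfolding there_and_back_def frothy_cycles_def by blast
qed

lemma there_and_back_equiv:
  assumes "fr e" "src e = mid y" "tgt e = mid z"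
  shows "(there_and_back e y z, loop_cycle y) \<in> cycle_eq"
    and "(there_and_back e y z, loop_cycle z) \<in> cycle_eq"
proof -
  note C = there_and_back_in[OF assms]
  show "(there_and_back e y z, loop_cycle y) \<in> cycle_eq"
    by (rule cycle_eq_if_common_edge[OF C(1) loop_cycle_in[OF C(2)] _
          loop_in_loop_cycle[of "\<not> isl e"]])
      (simp add: there_and_back_def)
  show "(there_and_back e y z, loop_cycle z) \<in> cycle_eq"
    by (rule cycle_eq_if_common_edge[OF C(1) loop_cycle_in[OF C(3)] _
          loop_in_loop_cycle[of "\<not> isl e"]])
      (simp add: there_and_back_def)
qed

lemma cycle_equiv_loop_cycle:
  assumes "C \<in> F"
  shows "\<exists>y \<in> inner. (C, loop_cycle y) \<in> cycle_eq"
proof -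
  obtain es where es: "C = cyclic_class es" "frothy_cycle_seq X Z (Psi \<alpha>) (Psi \<beta>) es"
    using assms by (auto simp: frothy_cycles_def)
  define e where "e = hd es"
  have e: "e \<in> set es" "fr e"
    using es(2) unfolding e_def by (auto simp: frothy_cycle_seq_def connected_seq_def)
  obtain y where y: "y \<in> inner" "src e = mid y" using frothy_src e(2) by blast
  obtain z where z: "src (rev_edge e) = mid z" using frothy_src frothy_rev_edge e(2) by blast
  then have z: "tgt e = mid z" by simp
  have "(C, there_and_back e y z) \<in> cycle_eq"
    using assms there_and_back_in[OF e(2) y(2) z] e(1) es(1)
    by (intro cycle_eq_if_common_edge[of _ _ e]) (auto simp: there_and_back_def)
  then have "(C, loop_cycle y) \<in> cycle_eq"
    using there_and_back_equiv(1)[OF e(2) y(2) z] by (rule cycle_eq_trans)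
  then show ?thesis using y(1) by blast
qed

lemma inner_eq_imp_cycle_eq:
  assumes "(y, z) \<in> inner_eq"
  shows "(loop_cycle y, loop_cycle z) \<in> cycle_eq"
proof -
  have y: "y \<in> inner" and linked: "linked_in (mid ` Y) \<alpha> \<beta> (mid y) (mid z)"
    using assms by (auto simp: inner_rel_def)
  have "\<exists>x \<in> inner. v = mid x \<and> (loop_cycle y, loop_cycle x) \<in> cycle_eq"
    if "linked_in (mid ` Y) \<alpha> \<beta> (mid y) v" for v
    using that
  proof (induction rule: linked_in_induct)
    case start
    have "(loop_cycle y, loop_cycle y) \<in> cycle_eq"
      by (rule cycle_eq_if_common_edge[OF loop_cycle_in[OF y] loop_cycle_in[OF y]
            loop_in_loop_cycle loop_in_loop_cycle])
    then show ?case using y by blast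
  next
    case (step u w)
    then obtain x where x: "x \<in> inner" "u = mid x" "(loop_cycle y, loop_cycle x) \<in> cycle_eq"
      by blast
    obtain x' where x': "w = mid x'" using step by blast
    obtain e where e: "e \<in> E" "src e = mid x" "tgt e = mid x'"
      using step.hyps(2) unfolding x(2) x' same_part_iff by blast
    then have fr: "fr e" using x(1) by (simp add: frothy_iff inner_points_iff)
    have "(loop_cycle x, loop_cycle x') \<in> cycle_eq"
      using there_and_back_equiv[OF fr e(2,3)] cycle_eq_sym cycle_eq_trans by blast
    then have "(loop_cycle y, loop_cycle x') \<in> cycle_eq"
      by (rule cycle_eq_trans[OF x(3)])
    then show ?case using x' there_and_back_in(3)[OF fr e(2,3)] by blast
  qed
  from this[OF linked] show ?thesis by auto
qed

definition points :: "('a, 'b, 'c) edge list set \<Rightarrow> 'b set" where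
  "points C = {y. mid y \<in> src ` cycle_edges C}"

lemma points_memI:
  assumes "e \<in> cycle_edges C" "src e = mid y"
  shows "y \<in> points C"
  unfolding points_def using assms by (metis imageI mem_Collect_eq)

lemma cycle_src:
  assumes "C \<in> F" "e \<in> cycle_edges C"
  obtains y where "y \<in> points C" "src e = mid y"
proof -
  obtain es where es: "C = cyclic_class es" "frothy_cycle_seq X Z (Psi \<alpha>) (Psi \<beta>) es"
    using assms by (auto simp: frothy_cycles_def)
  then have "fr e" using assms(2) by (auto simp: frothy_cycle_seq_def)
  then obtain y where "src e = mid y" using frothy_src by blast
  then show thesis using that points_memI[OF assms(2)] by blast
qed

lemma points_nonempty: "C \<in> F \<Longrightarrow> \<exists>y. y \<in> points C"
  using frothy_cycle_edge[of C] cycle_src[of C] unfolding cycle_edges_def by blast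

lemma points_connected:
  assumes "C \<in> F" "y \<in> points C" "z \<in> points C"
  shows "(y, z) \<in> inner_eq"
proof -
  obtain es where es: "C = cyclic_class es" "frothy_cycle_seq X Z (Psi \<alpha>) (Psi \<beta>) es"
    using assms by (auto simp: frothy_cycles_def)
  have conn: "conn es" and fr: "\<And>e. e \<in> set es \<Longrightarrow> fr e"
    using es(2) by (auto simp: frothy_cycle_seq_def)
  have "src e \<in> mid ` Y" if "e \<in> set es" for e
    using frothy_src[OF fr[OF that]] inner_points_iff by (metis imageI)
  then have "src ` set es \<subseteq> mid ` Y" by blast
  note link = conn_linked_src[OF conn this]
  have x: "x \<in> inner \<and> linked_in (mid ` Y) \<alpha> \<beta> (src (hd es)) (mid x)" if x: "x \<in> points C" for x
  proof -
    have "mid x \<in> src ` set es"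
      using x by (simp add: points_def es(1))
    then obtain e where e: "e \<in> set es" "src e = mid x"
      by (metis imageE)
    obtain x' where x': "x' \<in> inner" "src e = mid x'" by (rule frothy_src[OF fr[OF e(1)]])
    then show ?thesis using link[OF e(1)] e(2) by simp
  qed
  show ?thesis
    using x[OF assms(2)] x[OF assms(3)] linked_in_sym linked_in_trans
    unfolding inner_rel_def by blast
qed

text \<open>
  The invariant that separates the loop cycles of different components. All points of a frothy
  cycle lie in one component, which makes this relation reflexive, and transitive because every
  cycle has a point. It contains elementary equivalence, since a common edge provides a common
  point, and hence the equivalence generated by it.
\<close>

definition same_component where
  "same_component = {(C, D) \<in> F \<times> F. \<forall>y \<in> points C. \<forall>z \<in> points D. (y, z) \<in> inner_eq}"

lemma equiv_same_component: "equiv F same_component"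
proof (rule equivI)
  show "same_component \<subseteq> F \<times> F" by (auto simp: same_component_def)
  show "refl_on F same_component"
    unfolding refl_on_def same_component_def using points_connected by blast
  show "sym same_component"
    unfolding sym_def same_component_def using inner_eq_sym by blast
  show "trans same_component"
  proof (rule transI)
    fix B C D assume BC: "(B, C) \<in> same_component" and CD: "(C, D) \<in> same_component"
    then obtain x where "x \<in> points C" using points_nonempty[of C]
      by (auto simp: same_component_def)
    then show "(B, D) \<in> same_component"
      using BC CD inner_eq_trans unfolding same_component_def by blast
  qed
qed

lemma cycle_eq_subset_same_component: "cycle_eq \<subseteq> same_component"
proof -
  have "(C, D) \<in> same_component"
    if CD: "C \<in> F" "D \<in> F" "e \<in> cycle_edges C" "e \<in> cycle_edges D" for C D e
  proof -
    obtain x where x: "x \<in> points C" "src e = mid x" using cycle_src CD(1,3) by blast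
    then have "x \<in> points D" using points_memI[OF CD(4)] by blast
    then have "(y, z) \<in> inner_eq" if "y \<in> points C" "z \<in> points D" for y z
      using points_connected[OF CD(1) that(1) x(1)] points_connected[OF CD(2) _ that(2)]
        inner_eq_trans by blast
    then show ?thesis using CD by (auto simp: same_component_def)
  qed
  then have "elementary_equiv X Z (Psi \<alpha>) (Psi \<beta>) \<subseteq> same_component"
    unfolding elementary_equiv_def cycle_edges_def by blast
  then show ?thesis
    unfolding cycle_equiv_def using equiv_same_component by blast
qed

lemma points_loop_cycle: "y \<in> points (loop_cycle y)"
  by (rule points_memI[OF loop_in_loop_cycle[of True y]]) simp

text \<open>
  The map from inner points to loop cycles descends to a bijection of the quotients.
\<close>

lemma inner_count_eq_froth: "inner_count X Y Z \<alpha> \<beta> = froth X Z (Psi \<alpha>) (Psi \<beta>)"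
  unfolding inner_count_def froth_def
proof (rule card_quotient_eq[OF equiv_inner_rel equiv_cycle_equiv loop_cycle_in])
  fix y z
  show "(y, z) \<in> inner_eq \<longleftrightarrow> (loop_cycle y, loop_cycle z) \<in> cycle_eq"
    using inner_eq_imp_cycle_eq cycle_eq_subset_same_component points_loop_cycle
    unfolding same_component_def by blast
qed (use cycle_equiv_loop_cycle in blast)+

end

theorem proposition10:
  fixes X :: "'a set" and Y :: "'b set" and Z :: "'c set"
    and \<alpha> :: "('a, 'b) parts" and \<beta> :: "('b, 'c) parts" and k m :: nat
  assumes "finite X" and "finite Y" and "finite Z"
    and "(\<alpha>, k) \<in> Pbar X Y" and "(\<beta>, m) \<in> Pbar Y Z"
  shows "Psibar (pbar_comp X Y Z (\<beta>, m) (\<alpha>, k)) =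
         pbbar_comp X Z (Psibar (\<beta>, m)) (Psibar (\<alpha>, k))"
proof -
  interpret composable_partitions X Y Z \<alpha> \<beta>
    using assms(4,5) by unfold_locales (auto simp: Pbar_def Part_def)
  show ?thesis
    using Psi_part_comp inner_count_eq_froth by simp
qed

end
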